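(* For every real number $u_0$ with $0 \leq u_0 \leq 100$, the sequence $u_n = \Delta^n(u_0)$ satisfies one of the following: either $\lim_{n\to\infty} u_n = 0$, or there exists $N \in \mathbb{N}$ such that the integer parts of $u_N, u_{N+1}, u_{N+2}, \dots$ repeat the length-29 cycle $$(c_0,\dots,c_{28}) = (1,2,4,7,11,18,9,4,7,3,5,9,4,7,11,18,9,4,7,3,6,3,1,2,4,7,3,6,3),$$ i.e. $\lfloor u_{N+n} \rfloor = c_{n \bmod 29}$ for all integers $n \geq 0$.
   Context: For $x \in \mathbb{R}$, $\lfloor x \rfloor$ is the largest integer smaller than or equal to $x$, and $\operatorname{frac}(x) = x - \lfloor x \rfloor$. The function $\Delta : \mathbb{R} \to \mathbb{R}$ is defined by $\Delta(x) = \frac{x}{2}$ if $\operatorname{frac}(x) < \frac12$, and $\Delta(x) = \frac{3x+1}{2}$ if $\operatorname{frac}(x) \geq \frac12$. $\Delta^n$ denotes $n$ successive applications of $\Delta$ (with $\Delta^0$ the identity). *)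

theory Defs
  imports Complex_Main
begin

definition Delta :: "real \<Rightarrow> real" where
  "Delta x = (if frac x < 1/2 then x / 2 else (3 * x + 1) / 2)"

definition cyc :: "int list" where
  "cyc = [1,2,4,7,11,18,9,4,7,3,5,9,4,7,11,18,9,4,7,3,6,3,1,2,4,7,3,6,3]"

end

theory Submission
  imports Defs
begin

text \<open>
  If \<open>u\<^sub>0 < 1/2\<close>, every step halves. Otherwise write \<open>x = (k + g) / 2\<close> with an integer
  \<open>k \<ge> 1\<close> and \<open>0 \<le> g < 1\<close>. For \<open>k = 2 n\<close>, \<open>Delta\<close> sends \<open>(k, g)\<close> to \<open>(n, g / 2)\<close>; for
  \<open>k = 2 n + 1\<close>, it sends it to \<open>(3 n + 2, y)\<close> or \<open>(3 n + 3, y - 1)\<close> where \<open>y = (1 + 3 g) / 2\<close>,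
  according as \<open>y < 1\<close> or not. So an interval of values of \<open>g\<close> over a fixed \<open>k\<close> is mapped onto at
  most two such intervals. One turn around the cycle contracts by \<open>3\<^sup>1\<^sup>7 / 2\<^sup>2\<^sup>9\<close> and maps
  \<open>[195/128, 49/32)\<close> into itself; following the full intervals over \<open>k = 1, \<dots>, 200\<close>, every
  branch ends there after finitely many steps (about 700), even if the endpoints
  are rounded outwards to 16 binary digits before each step with odd \<open>k\<close>.
\<close>

subsection \<open>Points near the cycle\<close>

definition captured :: "real \<Rightarrow> bool" where
  "captured x \<longleftrightarrow> (\<exists>N. \<forall>n. \<lfloor>(Delta ^^ (N + n)) x\<rfloor> = cyc ! (n mod 29))"

lemma captured_if_Delta:
  assumes "captured (Delta x)"
  shows "captured x"
proof -
  obtain N where "\<forall>n. \<lfloor>(Delta ^^ (N + n)) (Delta x)\<rfloor> = cyc ! (n mod 29)"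
    using assms unfolding captured_def by blast
  then have "\<forall>n. \<lfloor>(Delta ^^ (Suc N + n)) x\<rfloor> = cyc ! (n mod 29)"
    by (simp add: funpow_swap1)
  then show ?thesis unfolding captured_def by blast
qed

lemma Delta_down:
  fixes n :: int
  assumes "of_int n \<le> x" and "x < of_int n + 1/2"
  shows "\<lfloor>x\<rfloor> = n" and "Delta x = x / 2"
proof -
  show "\<lfloor>x\<rfloor> = n" using assms by (simp add: floor_eq_iff)
  then show "Delta x = x / 2" using assms by (simp add: Delta_def frac_def)
qed

lemma Delta_up:
  fixes n :: int
  assumes "of_int n + 1/2 \<le> x" and "x < of_int n + 1"
  shows "\<lfloor>x\<rfloor> = n" and "Delta x = (3 * x + 1) / 2"
proof -
  show "\<lfloor>x\<rfloor> = n" using assms by (simp add: floor_eq_iff)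
  then show "Delta x = (3 * x + 1) / 2" using assms by (simp add: Delta_def frac_def)
qed

fun itinerary :: "(int \<times> bool) list \<Rightarrow> real \<Rightarrow> real set \<Rightarrow> bool" where
  "itinerary [] x S \<longleftrightarrow> x \<in> S"
| "itinerary ((c, up) # cs) x S \<longleftrightarrow>
    (if up then of_int c + 1/2 \<le> x \<and> x < of_int c + 1 \<and> itinerary cs ((3 * x + 1) / 2) S
     else of_int c \<le> x \<and> x < of_int c + 1/2 \<and> itinerary cs (x / 2) S)"

lemma itinerary_floor:
  assumes "itinerary cs x S"
  shows "(Delta ^^ length cs) x \<in> S \<and> (\<forall>i<length cs. \<lfloor>(Delta ^^ i) x\<rfloor> = fst (cs ! i))"
  using assms
proof (induction cs x S rule: itinerary.induct)
  case (1 x S)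
  then show ?case by simp
next
  case (2 c up cs x S)
  have c: "\<lfloor>x\<rfloor> = c"
    using "2.prems" Delta_up(1)[of c x] Delta_down(1)[of c x] by (auto split: if_splits)
  have "(Delta ^^ length cs) (Delta x) \<in> S
      \<and> (\<forall>i<length cs. \<lfloor>(Delta ^^ i) (Delta x)\<rfloor> = fst (cs ! i))"
  proof (cases up)
    case True
    have [simp]: "Delta x = (3 * x + 1) / 2" by (rule Delta_up[of c]) (use "2.prems" True in simp_all)
    then show ?thesis using "2.IH"(1) "2.prems" True by simp
  next
    case False
    have [simp]: "Delta x = x / 2" by (rule Delta_down[of c]) (use "2.prems" False in simp_all)
    then show ?thesis using "2.IH"(2) "2.prems" False by simp
  qed
  then show ?case using c
    by (auto simp: funpow_swap1 nth_Cons split: nat.split)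
qed

text \<open>On the cycle every integer part is at least 1, so it rises exactly when the step is
  \<open>(3 * x + 1) / 2\<close>; comparison with the cyclic successor recovers the branch.\<close>

definition cyc_ups :: "bool list" where
  "cyc_ups = map2 (<) cyc (rotate1 cyc)"

text \<open>For a concrete list \<open>itinerary\<close> unfolds to linear inequalities in
  \<open>x\<close>, including those for the return to the interval.\<close>

lemma cyc_itinerary:
  assumes "x \<in> {195/128..<49/32}"
  shows "itinerary (zip cyc cyc_ups) x {195/128..<49/32}"
  using assms by (simp add: cyc_ups_def cyc_def)

lemma captured_near_cycle:
  assumes "x \<in> {195/128..<49/32}"
  shows "captured x"
proof -
  let ?S = "{195/128..<49/32::real}"
  have len: "length (zip cyc cyc_ups) = 29" by (simp add: cyc_def cyc_ups_def)
  have ret: "(Delta ^^ (29 * m)) x \<in> ?S" for m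
  proof (induction m)
    case (Suc m)
    then show ?case
      using itinerary_floor[OF cyc_itinerary[OF Suc]] unfolding len
      by (simp only: mult_Suc_right funpow_add o_apply)
  qed (use assms in simp)
  have "\<lfloor>(Delta ^^ n) x\<rfloor> = cyc ! (n mod 29)" for n
  proof -
    have "n mod 29 < length (zip cyc cyc_ups)" unfolding len by simp
    then have "\<lfloor>(Delta ^^ (n mod 29)) ((Delta ^^ (29 * (n div 29))) x)\<rfloor>
        = fst (zip cyc cyc_ups ! (n mod 29))"
      using itinerary_floor[OF cyc_itinerary[OF ret]] by blast
    also have "(Delta ^^ (n mod 29)) ((Delta ^^ (29 * (n div 29))) x) = (Delta ^^ n) x"
      by (metis comp_apply funpow_add mod_mult_div_eq)
    also have "fst (zip cyc cyc_ups ! (n mod 29)) = cyc ! (n mod 29)"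
      by (subst nth_zip) (simp_all add: cyc_def cyc_ups_def)
    finally show ?thesis .
  qed
  then show ?thesis unfolding captured_def by (metis add_0)
qed

subsection \<open>Intervals with dyadic endpoints\<close>

text \<open>
  Binary fractions, most significant digit first. Lower endpoints are read with \<open>e = 0\<close>, upper
  ones (exclusive) with \<open>e = 1\<close>, i.e. with infinitely many further digits 1; then truncation
  rounds both outwards.
\<close>

fun bval :: "real \<Rightarrow> bool list \<Rightarrow> real" where
  "bval e [] = e"
| "bval e (b # bs) = (of_bool b + bval e bs) / 2"

lemma bval_bounds:
  "0 \<le> bval 0 bs" "bval 0 bs < 1" "0 < bval 1 bs" "bval 1 bs \<le> 1"
  by (induction bs) auto

lemma bval_take: "bval 0 (take n bs) \<le> bval 0 bs" "bval 1 bs \<le> bval 1 (take n bs)"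
proof (induction bs arbitrary: n)
  case (Cons b bs)
  { case 1 show ?case using Cons(1)[of "n - 1"] bval_bounds(1)[of "b # bs"] by (cases n) auto }
  { case 2 show ?case using Cons(2)[of "n - 1"] bval_bounds(4)[of "b # bs"] by (cases n) auto }
qed auto

text \<open>Long multiplication by 3, starting from the least significant digit: the constructor is
  the carry 0, 1 or 2, the list holds the digits produced so far.\<close>

datatype carry = C0 "bool list" | C1 "bool list" | C2 "bool list"

fun cval :: "real \<Rightarrow> carry \<Rightarrow> real" where
  "cval e (C0 bs) = bval e bs"
| "cval e (C1 bs) = 1 + bval e bs"
| "cval e (C2 bs) = 2 + bval e bs"

fun push :: "bool \<Rightarrow> carry \<Rightarrow> carry" where
  "push False (C0 bs) = C0 (False # bs)"
| "push False (C1 bs) = C0 (True # bs)"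
| "push False (C2 bs) = C1 (False # bs)"
| "push True (C0 bs) = C1 (True # bs)"
| "push True (C1 bs) = C2 (False # bs)"
| "push True (C2 bs) = C2 (True # bs)"

lemma cval_push: "cval e (push b t) = (3 * of_bool b + cval e t) / 2"
  by (cases "(b, t)" rule: push.cases) (auto simp: field_simps)

text \<open>The initial carry must have value \<open>3 * e\<close>: \<open>C0 []\<close> is 0 for
  \<open>e = 0\<close>, and \<open>C2 []\<close> is 2 + 1 for \<open>e = 1\<close>.\<close>

lemma cval_triple:
  "cval 0 (foldr push bs (C0 [])) = 3 * bval 0 bs"
  "cval 1 (foldr push bs (C2 [])) = 3 * bval 1 bs"
  by (induction bs) (auto simp: cval_push field_simps)

definition zeros :: "bool list" where
  "zeros = [False, False, False, False, False, False, False, False,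
            False, False, False, False, False, False, False, False]"

definition ones :: "bool list" where
  "ones = [True, True, True, True, True, True, True, True,
           True, True, True, True, True, True, True, True]"

lemma bval_zeros_ones: "bval 0 zeros = 0" "bval 1 ones = 1"
  by (simp_all add: zeros_def ones_def)

section \<open>Cells of points \<open>(k + g) / 2\<close> and their images under
  \<open>Delta\<close>\<close>

definition safe :: "num \<Rightarrow> bool list \<Rightarrow> bool list \<Rightarrow> bool" where
  "safe k l h \<longleftrightarrow> (\<forall>g. bval 0 l \<le> g \<longrightarrow> g < bval 1 h \<longrightarrow> captured ((numeral k + g) / 2))"

text \<open>The intermediate state of a step with odd \<open>k\<close>: the bounds are those of \<open>z = 3 g\<close>.\<close>

definition branch :: "num \<Rightarrow> carry \<Rightarrow> carry \<Rightarrow> bool" where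
  "branch k l h \<longleftrightarrow> (\<forall>z. cval 0 l \<le> z \<longrightarrow> z < cval 1 h \<longrightarrow> captured ((numeral k + (1 + z) / 2) / 2))"

text \<open>The quantifiers make a proved \<open>whole k\<close> a rewrite rule that closes every
  cell over \<open>k\<close>, whatever its interval.\<close>

abbreviation whole :: "num \<Rightarrow> bool" where
  "whole k \<equiv> \<forall>l h. safe k l h"

lemma whole_iff: "whole k \<longleftrightarrow> safe k zeros ones"
proof
  assume "safe k zeros ones"
  then have *: "captured ((numeral k + g) / 2)" if "0 \<le> g" "g < 1" for g
    using that by (simp add: safe_def bval_zeros_ones)
  show "whole k"
    unfolding safe_def
  proof (intro allI impI *)
    fix l h g assume "bval 0 l \<le> g" "g < bval 1 h"
    then show "0 \<le> g" "g < 1" using bval_bounds(1)[of l] bval_bounds(4)[of h] by linarith+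
  qed
qed blast

text \<open>The prefix 000011 confines \<open>g\<close> to [3/64, 1/16), hence
  \<open>(3 + g) / 2\<close> to [195/128, 49/32).\<close>

lemma safe_near_cycle:
  "safe (Num.Bit1 Num.One) (False#False#False#False#True#True#l) (False#False#False#False#True#True#h)"
  using bval_bounds(1)[of l] bval_bounds(4)[of h]
  unfolding safe_def by (auto intro!: captured_near_cycle simp: field_simps)

lemma safeD:
  assumes "safe k l h" and "bval 0 l \<le> g" and "g < bval 1 h"
  shows "captured ((numeral k + g) / 2)"
  using assms unfolding safe_def by blast

lemma Delta_half_even:
  fixes n :: int
  assumes "0 \<le> g" and "g < 1"
  shows "Delta ((2 * of_int n + g) / 2) = (of_int n + g / 2) / 2"
proof -
  have "Delta ((2 * of_int n + g) / 2) = (2 * of_int n + g) / 2 / 2"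
    by (rule Delta_down[of n]) (use assms in auto)
  then show ?thesis by simp
qed

lemma Delta_half_odd:
  fixes n :: int
  assumes "0 \<le> g" and "g < 1"
  shows "Delta ((2 * of_int n + 1 + g) / 2) = (3 * of_int n + 2 + (1 + 3 * g) / 2) / 2"
proof -
  have "Delta ((2 * of_int n + 1 + g) / 2) = (3 * ((2 * of_int n + 1 + g) / 2) + 1) / 2"
    by (rule Delta_up[of n]) (use assms in auto)
  also have "\<dots> = (3 * of_int n + 2 + (1 + 3 * g) / 2) / 2" by (simp add: field_simps)
  finally show ?thesis .
qed

text \<open>The outermost constructor of a \<open>num\<close> is its last binary digit, so matching
  reads off the parity; halving \<open>g\<close> prepends a digit 0.\<close>

lemma safe_even:
  assumes "safe k (False # l) (False # h)"
  shows "safe (Num.Bit0 k) l h"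
  unfolding safe_def
proof (intro allI impI)
  fix g assume g: "bval 0 l \<le> g" "g < bval 1 h"
  then have "0 \<le> g" "g < 1" using bval_bounds(1)[of l] bval_bounds(4)[of h] by linarith+
  then have step: "Delta ((numeral (Num.Bit0 k) + g) / 2) = (numeral k + g / 2) / 2"
    using Delta_half_even[of g "numeral k"] by (simp only: numeral_Bit0[of k] mult_2 of_int_numeral simp_thms)
  have "captured ((numeral k + g / 2) / 2)"
    by (rule safeD[OF assms]) (use g in simp_all)
  then show "captured ((numeral (Num.Bit0 k) + g) / 2)"
    unfolding step[symmetric] by (rule captured_if_Delta)
qed

text \<open>Here \<open>q\<close> is an integer, so that \<open>k = 1\<close> is covered with
  \<open>q = 0\<close>, which no \<open>num\<close> represents.\<close>

lemma branch_if_odd: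
  assumes "branch p (foldr push (take n l) (C0 [])) (foldr push (take n h) (C2 []))"
    and p: "numeral p = 3 * of_int q + (2 :: real)"
    and k: "numeral k = 2 * of_int q + (1 :: real)"
  shows "safe k l h"
  unfolding safe_def
proof (intro allI impI)
  fix g assume g: "bval 0 l \<le> g" "g < bval 1 h"
  then have "0 \<le> g" "g < 1" using bval_bounds(1)[of l] bval_bounds(4)[of h] by linarith+
  then have step: "Delta ((numeral k + g) / 2) = (numeral p + (1 + 3 * g) / 2) / 2"
    unfolding k p by (rule Delta_half_odd)
  have "3 * bval 0 (take n l) \<le> 3 * g" "3 * g < 3 * bval 1 (take n h)"
    using g bval_take(1)[of n l] bval_take(2)[of h n] by linarith+
  then have "captured ((numeral p + (1 + 3 * g) / 2) / 2)"
    using assms(1) unfolding branch_def cval_triple by blast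
  then show "captured ((numeral k + g) / 2)"
    unfolding step[symmetric] by (rule captured_if_Delta)
qed

lemma safe_One:
  assumes "branch (Num.Bit0 Num.One) (foldr push (take n l) (C0 [])) (foldr push (take n h) (C2 []))"
  shows "safe Num.One l h"
  by (rule branch_if_odd[OF assms, of 0]) simp_all

lemma safe_odd:
  assumes "branch (q + Num.Bit0 (q + Num.One)) (foldr push (take n l) (C0 [])) (foldr push (take n h) (C2 []))"
  shows "safe (Num.Bit1 q) l h"
proof (rule branch_if_odd[OF assms, of "numeral q"])
  \<comment> \<open>The index \<open>q + Num.Bit0 (q + Num.One)\<close> is
    \<open>q + 2 * (q + 1)\<close>.\<close>
  have "a + (a + 1 + (a + 1)) = 3 * a + 2" "a + a + 1 = 2 * a + 1" for a :: real by simp_all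
  from this[of "numeral q"]
  show "numeral (q + Num.Bit0 (q + Num.One)) = 3 * of_int (numeral q) + (2 :: real)"
    and "numeral (Num.Bit1 q) = 2 * of_int (numeral q) + (1 :: real)"
    by (simp_all only: numeral_add numeral_Bit0 numeral_Bit1 numeral_One of_int_numeral)
qed

text \<open>\<open>(1 + z) / 2\<close> reaches 1 exactly when \<open>z\<close> does; then one unit
  passes to the index and \<open>(z - 1) / 2\<close> remains.\<close>

lemma branchI:
  assumes "\<And>z. cval 0 l \<le> z \<Longrightarrow> z < cval 1 h \<Longrightarrow> z < 1 \<Longrightarrow>
      captured ((numeral k + (1 + z) / 2) / 2)"
    and "\<And>z. cval 0 l \<le> z \<Longrightarrow> z < cval 1 h \<Longrightarrow> 1 \<le> z \<Longrightarrow>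
      captured ((numeral (k + Num.One) + (z - 1) / 2) / 2)"
  shows "branch k l h"
  unfolding branch_def
proof (intro allI impI)
  fix z assume z: "cval 0 l \<le> z" "z < cval 1 h"
  have "a + (1 + z) / 2 = (a + 1) + (z - 1) / 2" for a :: real by (simp add: field_simps)
  then have "numeral k + (1 + z) / 2 = numeral (k + Num.One) + (z - 1) / 2"
    by (simp only: numeral_add numeral_One)
  then show "captured ((numeral k + (1 + z) / 2) / 2)"
    using assms(1)[OF z] assms(2)[OF z] by (cases "z < 1") (simp_all only: not_less)
qed

lemma branch_low:
  assumes "safe k (True # l) (True # h)"
  shows "branch k (C0 l) (C0 h)"
  using bval_bounds[of l] bval_bounds[of h]
  by (intro branchI safeD[OF assms]) auto

lemma branch_high:
  assumes "safe (k + Num.One) l' h'"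
  shows "l' = False # l \<Longrightarrow> h' = False # h \<Longrightarrow> branch k (C1 l) (C1 h)"
    and "l' = False # l \<Longrightarrow> h' = True # h \<Longrightarrow> branch k (C1 l) (C2 h)"
    and "l' = True # l \<Longrightarrow> h' = True # h \<Longrightarrow> branch k (C2 l) (C2 h)"
  using bval_bounds(1)[of l] by (intro branchI safeD[OF assms]; simp)+

text \<open>The bounds lie on either side of 1, so the image is cut into a piece ending at
  \<open>ones\<close> and one starting at \<open>zeros\<close>.\<close>

lemma branch_split:
  assumes "safe k (True # l) ones"
    and "safe (k + Num.One) zeros h'"
  shows "h' = False # h \<Longrightarrow> branch k (C0 l) (C1 h)"
    and "h' = True # h \<Longrightarrow> branch k (C0 l) (C2 h)"
proof -
  have low: "captured ((numeral k + (1 + z) / 2) / 2)" if "bval 0 l \<le> z" "z < 1" for z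
    by (rule safeD[OF assms(1)]) (use that in \<open>auto simp: bval_zeros_ones\<close>)
  have high: "captured ((numeral (k + Num.One) + (z - 1) / 2) / 2)"
    if "1 \<le> z" "(z - 1) / 2 < bval 1 h'" for z
    by (rule safeD[OF assms(2)]) (use that in \<open>auto simp: bval_zeros_ones\<close>)
  show "branch k (C0 l) (C1 h)" if "h' = False # h"
    by (intro branchI low high) (use that in auto)
  show "branch k (C0 l) (C2 h)" if "h' = True # h"
    by (intro branchI low high) (use that in auto)
qed

text \<open>The pattern fits all lists of at least 16 digits and performs the truncation by
  matching, leaving only \<open>push\<close> to evaluate.\<close>

lemma safe_One_16:
  assumes "branch (Num.Bit0 Num.One)
    (push a1 (push a2 (push a3 (push a4 (push a5 (push a6 (push a7 (push a8 (push a9 (push a10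
    (push a11 (push a12 (push a13 (push a14 (push a15 (push a16 (C0 [])))))))))))))))))
    (push b1 (push b2 (push b3 (push b4 (push b5 (push b6 (push b7 (push b8 (push b9 (push b10
    (push b11 (push b12 (push b13 (push b14 (push b15 (push b16 (C2 [])))))))))))))))))"
  shows "safe Num.One
    (a1 # a2 # a3 # a4 # a5 # a6 # a7 # a8 # a9 # a10 # a11 # a12 # a13 # a14 # a15 # a16 # l)
    (b1 # b2 # b3 # b4 # b5 # b6 # b7 # b8 # b9 # b10 # b11 # b12 # b13 # b14 # b15 # b16 # h)"
  using assms by (intro safe_One[where n = 16]) simp

lemma safe_odd_16:
  assumes "branch (q + Num.Bit0 (q + Num.One))
    (push a1 (push a2 (push a3 (push a4 (push a5 (push a6 (push a7 (push a8 (push a9 (push a10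
    (push a11 (push a12 (push a13 (push a14 (push a15 (push a16 (C0 [])))))))))))))))))
    (push b1 (push b2 (push b3 (push b4 (push b5 (push b6 (push b7 (push b8 (push b9 (push b10
    (push b11 (push b12 (push b13 (push b14 (push b15 (push b16 (C2 [])))))))))))))))))"
  shows "safe (Num.Bit1 q)
    (a1 # a2 # a3 # a4 # a5 # a6 # a7 # a8 # a9 # a10 # a11 # a12 # a13 # a14 # a15 # a16 # l)
    (b1 # b2 # b3 # b4 # b5 # b6 # b7 # b8 # b9 # b10 # b11 # b12 # b13 # b14 # b15 # b16 # h)"
  using assms by (intro safe_odd[where n = 16]) simp

subsection \<open>The finite search\<close>

lemmas search_rules =
  whole_iff zeros_def ones_def safe_near_cycle safe_One_16 safe_odd_16 safe_even
  branch_low branch_high[OF _ refl refl] branch_split[OF _ _ refl] push.simps add_num_simps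

text \<open>
  Every step of the search is an application of a conditional rewrite rule whose condition is
  the remaining search, so the simplifier nests as deeply as the orbits are long.
\<close>

declare [[simp_depth_limit = 100000]]

text \<open>
  Proved cells serve as leaves of the later searches. Those over 141 and 189 come before the
  smaller ones because 61, 93 lead to 141, and 83, 125 lead to 189, with full intervals.
\<close>

lemma whole_1: "whole Num.One"
  by (simp only: search_rules)

lemma whole_3: "whole (Num.Bit1 Num.One)"
  by (simp only: search_rules whole_1)

lemma whole_13: "whole (Num.Bit1 (Num.Bit0 (Num.Bit1 Num.One)))"
  by (simp only: search_rules whole_1 whole_3)

lemma whole_141: "whole (Num.Bit1 (Num.Bit0 (Num.Bit1 (Num.Bit1 (Num.Bit0 (Num.Bit0 (Num.Bit0 Num.One)))))))"
  by (simp only: search_rules whole_1 whole_3 whole_13)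

lemma whole_189: "whole (Num.Bit1 (Num.Bit0 (Num.Bit1 (Num.Bit1 (Num.Bit1 (Num.Bit1 (Num.Bit0 Num.One)))))))"
  by (simp only: search_rules whole_1 whole_3 whole_13 whole_141)

lemma whole_upto_200: "list_all whole (map num_of_nat [1..<201])"
proof -
  \<comment> \<open>The entry 1 is split off since \<open>upt_rec_numeral\<close> acts on bounds of
    the form \<open>numeral _\<close>.\<close>
  have upt: "[1..<201] = (1 :: nat) # [2..<201]"
    by (subst upt_conv_Cons) (simp_all add: numeral_2_eq_2)
  have "list_all (\<lambda>k. safe k zeros ones) (map num_of_nat [1..<201])"
    unfolding upt
    by (simp add: upt_rec_numeral,
      simp only: search_rules whole_1 whole_3 whole_13 whole_141 whole_189 simp_thms)
  then show ?thesis by (simp only: whole_iff)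
qed

lemma captured_if_ge_half:
  assumes "1/2 \<le> x" and "x \<le> 100"
  shows "captured x"
proof -
  \<comment> \<open>\<open>x\<close> is \<open>(k + frac (2 * x)) / 2\<close>, and
    \<open>x \<le> 100\<close> gives \<open>k \<le> 200\<close>.\<close>
  define k where "k = nat \<lfloor>2 * x\<rfloor>"
  have k: "real k = of_int \<lfloor>2 * x\<rfloor>" "1 \<le> k" "k < 201"
    unfolding k_def using assms by (auto simp: le_nat_iff nat_less_iff le_floor_iff floor_less_iff)
  have "whole (num_of_nat k)"
    using whole_upto_200 k by (simp add: list_all_iff del: upt.simps)
  then have "safe (num_of_nat k) zeros ones" by blast
  moreover have "numeral (num_of_nat k) = real k"
    using k by (metis nat_of_num_numeral num_of_nat_inverse of_nat_numeral zero_less_one order_less_le_trans)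
  ultimately have "captured ((real k + frac (2 * x)) / 2)"
    using frac_lt_1[of "2 * x"] by (simp add: safe_def bval_zeros_ones)
  then show ?thesis using k by (simp add: frac_def)
qed

lemma Delta_funpow_small:
  assumes "0 \<le> x" and "x < 1/2"
  shows "(Delta ^^ n) x = x / 2 ^ n"
proof (induction n)
  case (Suc n)
  have "x / 2 ^ n \<le> x" using assms(1) by (simp add: divide_le_eq mult_le_cancel_left1)
  then have "x / 2 ^ n < of_int 0 + 1/2" using assms(2) by linarith
  then have "Delta (x / 2 ^ n) = x / 2 ^ n / 2"
    using assms(1) by (intro Delta_down(2)[of 0]) simp_all
  with Suc show ?case by simp
qed simp

theorem theorem1:
  fixes u\<^sub>0 :: real
  assumes "0 \<le> u\<^sub>0" and "u\<^sub>0 \<le> 100"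
  shows "(\<lambda>n. (Delta ^^ n) u\<^sub>0) \<longlonglongrightarrow> 0 \<or>
    (\<exists>N. \<forall>n. \<lfloor>(Delta ^^ (N + n)) u\<^sub>0\<rfloor> = cyc ! (n mod 29))"
proof (cases "u\<^sub>0 < 1/2")
  case True
  have "(\<lambda>n. u\<^sub>0 / 2 ^ n) \<longlonglongrightarrow> 0"
    by (rule LIMSEQ_divide_realpow_zero) simp
  with True show ?thesis using assms(1) by (simp add: Delta_funpow_small)
next
  case False
  then show ?thesis
    using captured_if_ge_half[of u\<^sub>0] assms(2) unfolding captured_def by simp
qed

end
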